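(* Let $A=\{a_1,a_2,a_3\}$, where $a_1<a_2<a_3$ are positive integers with $\gcd(a_1,a_2,a_3)=1$. Suppose that there exist a positive integer $a$ and $t\in\{2,3,4,5,7\}$ such that $a\in A$ and $at\in A$. Then $p_A(3)=\{p_{a_1}(3),p_{a_2}(3),p_{a_3}(3)\}$ is a regular sequence in $R_3=\mathbb{C}[x_1,x_2,x_3]$ if and only if $a_1a_2a_3\equiv 0\pmod 6$.
   Context: For $k\ge 1$, $p_k(3)=x_1^k+x_2^k+x_3^k\in R_3=\mathbb{C}[x_1,x_2,x_3]$ is the power sum of degree $k$ in three variables. A set of three homogeneous polynomials (of positive degree) in $R_3$ is a regular sequence if and only if their only common zero in $\mathbb{C}^3$ is $(0,0,0)$. *)

theory Defs
  imports Complex_Main "HOL-Library.Poly_Mapping" "HOL-Library.Numeral_Type"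
    "HOL-Number_Theory.Cong"
begin

text \<open>
  Polynomials with complex coefficients in variables indexed by \<open>'n\<close>: finitely supported maps
  from exponent vectors to coefficients, with the convolution product.  The numeral type
  \<open>3\<close> has exactly three elements, so \<open>3 mpoly_complex\<close> is \<open>\<complex>[x\<^sub>1, x\<^sub>2, x\<^sub>3]\<close>.
\<close>
type_synonym 'n mpoly_complex = "('n \<Rightarrow>\<^sub>0 nat) \<Rightarrow>\<^sub>0 complex"

definition pvar :: "'n \<Rightarrow> 'n mpoly_complex"
  where "pvar i = Poly_Mapping.single (Poly_Mapping.single i 1) 1"

definition power_sum :: "nat \<Rightarrow> 'n::finite mpoly_complex"
  where "power_sum k = (\<Sum>i\<in>UNIV. pvar i ^ k)"

text \<open>Ideals are the submodules of a commutative ring regarded as a module over itself.\<close>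
lemma module_times: "module ((*) :: 'a::comm_ring_1 \<Rightarrow> 'a \<Rightarrow> 'a)"
  by unfold_locales (simp_all add: algebra_simps)

definition ideal_gen :: "'a::comm_ring_1 set \<Rightarrow> 'a set"
  where "ideal_gen F = module.span (*) F"

text \<open>
  The first conjunct says that \<open>fs ! i\<close> is a non-zero-divisor modulo the ideal generated by its
  predecessors, the second that the quotient by the whole ideal is nonzero.
\<close>
definition regular_sequence :: "'a::comm_ring_1 list \<Rightarrow> bool"
  where "regular_sequence fs \<longleftrightarrow>
    (\<forall>i<length fs. \<forall>g. g * fs ! i \<in> ideal_gen (set (take i fs))
        \<longrightarrow> g \<in> ideal_gen (set (take i fs))) \<and>
    ideal_gen (set fs) \<noteq> UNIV"

end

theory Submission
  imports Defs "HOL-Computational_Algebra.Fundamental_Theorem_Algebra"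
begin

text \<open>
  If no \<open>a\<^sub>i\<close> is even then all three power sums lie in the ideal \<open>(x + y, z)\<close>, and if none is a
  multiple of \<open>3\<close> they lie in the ideal of the first two elementary symmetric polynomials. Three
  elements of an ideal \<open>(u, v)\<close> cannot form a regular sequence, by Cramer's rule.

  Conversely, let \<open>a, a t, c\<close> be the exponents and \<open>X = x\<^sup>a, Y = y\<^sup>a, Z = z\<^sup>a\<close>. For \<open>t \<in> {2, 3, 4, 5, 7}\<close>,
  Newton's identities show that modulo \<open>p\<^sub>a = X + Y + Z\<close> the polynomial \<open>p\<^bsub>a t\<^esub>\<close> is a constant times a
  monomial in \<open>X Y Z\<close> and \<open>X\<^sup>2 + X Y + Y\<^sup>2\<close>, hence a product of linear forms \<open>x\<close>, \<open>y\<close>, \<open>z\<close> and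
  \<open>x - \<zeta> y\<close> with \<open>\<zeta>\<^sup>a\<close> a primitive cube root of unity. Modulo one such form, \<open>p\<^sub>a\<close> itself splits
  into linear forms. So \<open>p\<^sub>c\<close> is a non-zero-divisor modulo \<open>(p\<^sub>a, p\<^bsub>a t\<^esub>)\<close> as soon as it does not
  vanish at the finitely many resulting points, which are roots of unity up to scaling; this is
  where \<open>gcd a c = 1\<close> and \<open>6 dvd a (a t) c\<close> are used. Homogeneity permits sorting the exponents.
\<close>

subsection \<open>Non-zero-divisors modulo an ideal\<close>

lemma mem_ideal_gen_empty: "x \<in> ideal_gen {} \<longleftrightarrow> x = (0::'a::comm_ring_1)"
  by (simp add: ideal_gen_def module.span_empty[OF module_times])

lemma mem_ideal_gen_singleton: "x \<in> ideal_gen {p} \<longleftrightarrow> (p::'a::comm_ring_1) dvd x"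
  by (auto simp: ideal_gen_def module.span_singleton[OF module_times] dvd_def mult.commute)

lemma mem_ideal_gen_insert:
  "x \<in> ideal_gen (insert p S) \<longleftrightarrow> (\<exists>k. x - k * (p::'a::comm_ring_1) \<in> ideal_gen S)"
  by (simp add: ideal_gen_def module.span_insert[OF module_times])

lemma mem_ideal_gen_pair: "x \<in> ideal_gen {p, q} \<longleftrightarrow> (\<exists>u v. x = u * p + v * (q::'a::comm_ring_1))"
proof -
  have "q dvd x - u * p \<longleftrightarrow> (\<exists>v. x = u * p + v * q)" for u
  proof -
    have "x - u * p = q * v \<longleftrightarrow> x = u * p + v * q" for v
      unfolding diff_eq_eq by (simp only: add.commute mult.commute[of q])
    then show ?thesis
      by (simp add: dvd_def)
  qed
  then show ?thesis
    by (simp add: mem_ideal_gen_insert[of x p] mem_ideal_gen_singleton)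
qed

lemma ideal_gen_add: "x \<in> ideal_gen S \<Longrightarrow> y \<in> ideal_gen S \<Longrightarrow> x + y \<in> ideal_gen S"
  unfolding ideal_gen_def by (rule module.span_add[OF module_times])

lemma ideal_gen_mult: "x \<in> ideal_gen S \<Longrightarrow> a * x \<in> ideal_gen S"
  unfolding ideal_gen_def by (rule module.span_scale[OF module_times])

definition nzd_mod :: "'a::comm_ring_1 set \<Rightarrow> 'a \<Rightarrow> bool"
  where "nzd_mod F f \<longleftrightarrow> (\<forall>g. g * f \<in> ideal_gen F \<longrightarrow> g \<in> ideal_gen F)"

lemma nzd_modD: "nzd_mod F f \<Longrightarrow> g * f \<in> ideal_gen F \<Longrightarrow> g \<in> ideal_gen F"
  unfolding nzd_mod_def by blast

lemma nzd_mod_singletonD: "nzd_mod {p} f \<Longrightarrow> p dvd g * f \<Longrightarrow> p dvd g"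
  unfolding nzd_mod_def mem_ideal_gen_singleton by blast

lemma regular_sequence_3:
  "regular_sequence [f, g, h] \<longleftrightarrow>
    nzd_mod {} f \<and> nzd_mod {f} g \<and> nzd_mod {f, g} h \<and> 1 \<notin> ideal_gen {f, g, h}"
proof -
  have "1 \<in> ideal_gen S \<longleftrightarrow> ideal_gen S = UNIV" for S :: "'a set"
  proof
    assume "1 \<in> ideal_gen S"
    then have "x * 1 \<in> ideal_gen S" for x
      unfolding ideal_gen_def by (rule module.span_scale[OF module_times])
    then show "ideal_gen S = UNIV"
      by auto
  qed simp
  moreover have "(\<forall>i<Suc (Suc (Suc 0)). Q i) \<longleftrightarrow> Q 0 \<and> Q (Suc 0) \<and> Q (Suc (Suc 0))"
    for Q :: "nat \<Rightarrow> bool"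
    by (auto simp: less_Suc_eq)
  ultimately show ?thesis
    unfolding regular_sequence_def nzd_mod_def by simp
qed

lemma nzd_mod_empty: "nzd_mod {} f" if "f \<noteq> 0" for f :: "'a::idom"
  using that by (simp add: nzd_mod_def mem_ideal_gen_empty)

lemma nzd_mod_mult: "nzd_mod F f \<Longrightarrow> nzd_mod F g \<Longrightarrow> nzd_mod F (f * g)"
  unfolding nzd_mod_def by (metis mult.assoc mult.commute)

lemma nzd_mod_one: "nzd_mod F 1"
  by (simp add: nzd_mod_def)

text \<open>Congruent elements act in the same way on the quotient by \<open>p\<close>.\<close>

lemma nzd_mod_cong:
  assumes "p dvd f - g" "nzd_mod {p} f"
  shows "nzd_mod {p} g"
  unfolding nzd_mod_def mem_ideal_gen_singleton
proof (intro allI impI)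
  fix h assume "p dvd h * g"
  moreover have "p dvd h * (f - g)"
    using assms(1) by simp
  ultimately have "p dvd h * g + h * (f - g)"
    by (rule dvd_add)
  then show "p dvd h"
    using assms(2) by (auto simp: algebra_simps dest: nzd_mod_singletonD)
qed

lemma ideal_gen_pair_cong:
  assumes "(p::'a::comm_ring_1) dvd q - q'"
  shows "ideal_gen {p, q} = ideal_gen {p, q'}"
proof -
  have *: "ideal_gen {p, q} \<subseteq> ideal_gen {p, q'}" if dv: "p dvd q - q'" for q q'
  proof
    fix x assume "x \<in> ideal_gen {p, q}"
    then obtain u v where x: "x = u * p + v * q"
      by (auto simp: mem_ideal_gen_pair)
    obtain k where "q = q' + p * k"
      using dv by (auto simp: dvd_def algebra_simps)
    then have "x = (u + v * k) * p + v * q'"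
      by (simp add: x algebra_simps)
    then show "x \<in> ideal_gen {p, q'}"
      unfolding mem_ideal_gen_pair by blast
  qed
  from assms have "p dvd q' - q"
    by (metis dvd_minus_iff minus_diff_eq)
  with * assms show ?thesis
    by blast
qed

lemma nzd_mod_pair_cong: "p dvd q - q' \<Longrightarrow> nzd_mod {p, q} f \<Longrightarrow> nzd_mod {p, q'} f"
  using ideal_gen_pair_cong[of p q q'] unfolding nzd_mod_def by metis

lemma nzd_mod_pair_one: "nzd_mod {p, 1} f"
proof -
  have "g \<in> ideal_gen {p, 1}" for g
    unfolding mem_ideal_gen_pair by (rule exI[of _ 0], rule exI[of _ g]) simp
  then show ?thesis
    by (simp add: nzd_mod_def)
qed

text \<open>Multiplication by \<open>a\<close> maps the quotient by \<open>{p, b}\<close> into that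
  by \<open>{p, a * b}\<close> with cokernel the quotient by \<open>{p, a}\<close>; it is injective
  because \<open>a\<close> cancels modulo \<open>p\<close>. Cancelling \<open>f\<close> on both ends
  then gives it in the middle.\<close>

lemma nzd_mod_pair_mult:
  assumes "nzd_mod {p} a" "nzd_mod {p, a} f" "nzd_mod {p, b} f"
  shows "nzd_mod {p, a * b} f"
  unfolding nzd_mod_def
proof (intro allI impI)
  fix g assume "g * f \<in> ideal_gen {p, a * b}"
  then obtain u v where uv: "g * f = u * p + v * (a * b)"
    by (auto simp: mem_ideal_gen_pair)
  then have "g * f = u * p + (v * b) * a"
    by (simp add: algebra_simps)
  then have "g \<in> ideal_gen {p, a}"
    using assms(2) unfolding nzd_mod_def mem_ideal_gen_pair by blast
  then obtain r s where rs: "g = r * p + s * a"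
    by (auto simp: mem_ideal_gen_pair)
  have "(s * f - v * b) * a = p * (u - r * f)"
    using uv unfolding rs by (simp add: algebra_simps)
  then have "p dvd s * f - v * b"
    using assms(1) by (metis dvd_triv_left nzd_mod_singletonD)
  then obtain k where "s * f - v * b = p * k" ..
  then have "s * f = k * p + v * b"
    by (simp add: algebra_simps)
  then have "s \<in> ideal_gen {p, b}"
    using assms(3) unfolding nzd_mod_def mem_ideal_gen_pair by blast
  then obtain i j where "s = i * p + j * b"
    by (auto simp: mem_ideal_gen_pair)
  then have "g = (r + i * a) * p + j * (a * b)"
    by (simp add: rs algebra_simps)
  then show "g \<in> ideal_gen {p, a * b}"
    unfolding mem_ideal_gen_pair by blast
qed

text \<open>In a relation \<open>m * f = g * n\<close> the assumption makes \<open>f\<close> divide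
  \<open>n\<close>, and in a domain \<open>f\<close> then cancels.\<close>

lemma nzd_mod_swap:
  fixes f g :: "'a::idom"
  assumes "f \<noteq> 0" "nzd_mod {f} g"
  shows "nzd_mod {g} f"
  unfolding nzd_mod_def mem_ideal_gen_singleton
proof (intro allI impI)
  fix m assume "g dvd m * f"
  then obtain n where n: "m * f = g * n" ..
  have "f dvd m * f"
    by simp
  then have "f dvd n * g"
    using n by (metis mult.commute)
  then have "f dvd n"
    using assms(2) by (rule nzd_mod_singletonD[rotated])
  then obtain k where k: "n = f * k" ..
  have "m * f = (g * k) * f"
    unfolding n k by (simp only: mult_ac)
  then have "m = g * k"
    unfolding mult_right_cancel[OF assms(1)] .
  then show "g dvd m" by simp
qed

text \<open>The sequence \<open>p, q, f\<close> is regular up to the conditions on \<open>p\<close> and on the quotient; \<open>q\<close>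
  comes last because it is the entry that gets factored.\<close>
definition weakly_regular :: "'a::comm_ring_1 \<Rightarrow> 'a \<Rightarrow> 'a \<Rightarrow> bool"
  where "weakly_regular p f q \<longleftrightarrow> nzd_mod {p} q \<and> nzd_mod {p, q} f"

lemma weakly_regular_one: "weakly_regular p f 1"
  by (simp add: weakly_regular_def nzd_mod_one nzd_mod_pair_one)

text \<open>This closure under products reduces a factored last entry to its linear factors.\<close>

lemma weakly_regular_mult:
  "weakly_regular p f a \<Longrightarrow> weakly_regular p f b \<Longrightarrow> weakly_regular p f (a * b)"
  unfolding weakly_regular_def by (blast intro: nzd_mod_mult nzd_mod_pair_mult)

lemma weakly_regular_power: "weakly_regular p f a \<Longrightarrow> weakly_regular p f (a ^ n)"
  by (induction n) (auto intro: weakly_regular_one weakly_regular_mult)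

lemma weakly_regular_prod_mset:
  "(\<And>a. a \<in># A \<Longrightarrow> weakly_regular p f (q a)) \<Longrightarrow> weakly_regular p f (\<Prod>a\<in>#A. q a)"
  by (induction A) (auto intro: weakly_regular_one weakly_regular_mult)

text \<open>Serves the numerical coefficients in Newton's identities. The quotient by a unit is
  zero, so cancelling \<open>f\<close> there is trivial.\<close>

lemma weakly_regular_unit:
  assumes "c dvd 1"
  shows "weakly_regular p f c"
proof -
  obtain d where d: "1 = c * d"
    using assms ..
  have "nzd_mod {p} c"
    unfolding nzd_mod_def mem_ideal_gen_singleton
  proof (intro allI impI)
    fix g assume "p dvd g * c"
    then have "p dvd (g * c) * d"
      by (rule dvd_mult2)
    then show "p dvd g"
      using d by (simp add: mult.assoc)
  qed
  moreover have "g \<in> ideal_gen {p, c}" for g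
    unfolding mem_ideal_gen_pair
    by (rule exI[of _ 0], rule exI[of _ "g * d"]) (simp add: mult.assoc mult.commute[of d] flip: d)
  then have "nzd_mod {p, c} f"
    by (simp add: nzd_mod_def)
  ultimately show ?thesis
    by (simp add: weakly_regular_def)
qed

lemma weakly_regular_cong: "p dvd q - q' \<Longrightarrow> weakly_regular p f q \<Longrightarrow> weakly_regular p f q'"
  unfolding weakly_regular_def by (blast intro: nzd_mod_cong nzd_mod_pair_cong)

subsection \<open>Evaluation of polynomials\<close>

text \<open>A \<complex>-algebra structure on the target, so that one evaluation map serves for
  points, substitutions, the grading and parametrized lines.\<close>

locale complex_algebra =
  fixes h :: "complex \<Rightarrow> 'b::comm_ring_1"
  assumes hom_add: "h (c + d) = h c + h d"
    and hom_mult: "h (c * d) = h c * h d"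
    and hom_one: "h 1 = 1"
begin

lemma hom_zero: "h 0 = 0"
  using hom_add[of 0 0] by simp

lemma hom_uminus: "h (- c) = - h c"
  using hom_add[of c "- c"] by (simp add: eq_neg_iff_add_eq_0 add.commute hom_zero)

lemma hom_diff: "h (c - d) = h c - h d"
  using hom_add[of c "- d"] by (simp add: hom_uminus)

lemma hom_power: "h (c ^ n) = h c ^ n"
  by (induction n) (simp_all add: hom_mult hom_one)

lemma hom_unit: "c \<noteq> 0 \<Longrightarrow> h c dvd 1"
  using hom_mult[of c "inverse c"] by (metis dvd_triv_left hom_one right_inverse)

end

definition mpoly_eval :: "(complex \<Rightarrow> 'b::comm_ring_1) \<Rightarrow> ('n \<Rightarrow> 'b) \<Rightarrow> 'n::finite mpoly_complex \<Rightarrow> 'b"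
  where "mpoly_eval h \<sigma> p =
    (\<Sum>m\<in>Poly_Mapping.keys p. h (Poly_Mapping.lookup p m) * (\<Prod>i\<in>UNIV. \<sigma> i ^ Poly_Mapping.lookup m i))"

definition mconst :: "complex \<Rightarrow> 'n mpoly_complex"
  where "mconst c = Poly_Mapping.single 0 c"

interpretation mconst: complex_algebra mconst
  by unfold_locales (simp_all add: mconst_def single_add mult_single)

lemma poly_mapping_sum_induct [case_names single add]:
  assumes single: "\<And>m c. P (Poly_Mapping.single m (c::'b::comm_monoid_add))"
    and add: "\<And>p q. P p \<Longrightarrow> P q \<Longrightarrow> P (p + q)"
  shows "P p"
proof -
  have "P (\<Sum>m\<in>A. Poly_Mapping.single m (Poly_Mapping.lookup p m))" for A
  proof (induction A rule: infinite_finite_induct)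
    case (insert x F)
    then show ?case by (simp add: add single)
  \<comment> \<open>Empty and infinite sums are \<open>0\<close>, which is a monomial with
    coefficient \<open>0\<close>.\<close>
  qed (use single[of undefined 0] in simp_all)
  moreover have "(\<Sum>m\<in>Poly_Mapping.keys p. Poly_Mapping.single m (Poly_Mapping.lookup p m)) = p"
    by (rule poly_mapping_eqI) (simp add: lookup_sum lookup_single when_def in_keys_iff)
  ultimately show ?thesis
    by metis
qed

lemma pvar_power: "pvar i ^ k = Poly_Mapping.single (Poly_Mapping.single i k) 1"
  by (induction k) (simp_all add: pvar_def mult_single flip: single_add)

lemma single_eq_mconst_mult_prod_pvar:
  fixes m :: "'n::finite \<Rightarrow>\<^sub>0 nat"
  shows "Poly_Mapping.single m c = mconst c * (\<Prod>i\<in>UNIV. pvar i ^ Poly_Mapping.lookup m i)"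
proof -
  have "(\<Prod>i\<in>A. Poly_Mapping.single (f i) (1::complex)) = Poly_Mapping.single (\<Sum>i\<in>A. f i) 1"
    for f :: "'n \<Rightarrow> 'n \<Rightarrow>\<^sub>0 nat" and A
    by (induction A rule: infinite_finite_induct) (simp_all add: mult_single)
  moreover have "(\<Sum>i\<in>UNIV. Poly_Mapping.single i (Poly_Mapping.lookup m i)) = m"
    by (rule poly_mapping_eqI) (simp add: lookup_sum lookup_single when_def)
  ultimately show ?thesis
    by (simp add: pvar_power mconst_def mult_single)
qed

lemma mpoly_complex_induct [case_names const var add mult]:
  fixes p :: "'n::finite mpoly_complex"
  assumes const: "\<And>c. P (mconst c)"
    and var: "\<And>i. P (pvar i)"
    and add: "\<And>p q. P p \<Longrightarrow> P q \<Longrightarrow> P (p + q)"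
    and mult: "\<And>p q. P p \<Longrightarrow> P q \<Longrightarrow> P (p * q)"
  shows "P p"
proof (induction p rule: poly_mapping_sum_induct)
  case (single m c)
  have "P (pvar i ^ k)" for i k
    using const[of 1] by (induction k) (simp_all add: var mult mconst.hom_one)
  then have "P (\<Prod>i\<in>A. pvar i ^ Poly_Mapping.lookup m i)" for A
    using const[of 1] by (induction A rule: infinite_finite_induct) (simp_all add: mult mconst.hom_one)
  then show ?case
    by (simp add: single_eq_mconst_mult_prod_pvar const mult)
qed (rule add)

context complex_algebra
begin

text \<open>Gives \<open>p\<close>, \<open>q\<close> and \<open>p + q\<close> a common index set, as
  cancellation may shrink the keys of the sum.\<close>

lemma mpoly_eval_superset:
  assumes "finite A" "Poly_Mapping.keys p \<subseteq> A"
  shows "mpoly_eval h \<sigma> p =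
    (\<Sum>m\<in>A. h (Poly_Mapping.lookup p m) * (\<Prod>i\<in>UNIV. \<sigma> i ^ Poly_Mapping.lookup m i))"
  unfolding mpoly_eval_def
  using assms by (intro sum.mono_neutral_left) (auto simp: in_keys_iff hom_zero)

lemma mpoly_eval_add: "mpoly_eval h \<sigma> (p + q) = mpoly_eval h \<sigma> p + mpoly_eval h \<sigma> q"
proof -
  let ?A = "Poly_Mapping.keys p \<union> Poly_Mapping.keys q"
  have "finite ?A" by simp
  then show ?thesis
    using keys_add[of p q]
    by (simp add: mpoly_eval_superset[of ?A] lookup_add hom_add distrib_right sum.distrib)
qed

lemma mpoly_eval_single:
  "mpoly_eval h \<sigma> (Poly_Mapping.single m c) = h c * (\<Prod>i\<in>UNIV. \<sigma> i ^ Poly_Mapping.lookup m i)"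
  by (subst mpoly_eval_superset[of "{m}"]) (simp_all add: lookup_single)

lemma mpoly_eval_mult: "mpoly_eval h \<sigma> (p * q) = mpoly_eval h \<sigma> p * mpoly_eval h \<sigma> q"
proof (induction p rule: poly_mapping_sum_induct)
  case (single m c)
  show ?case
  proof (induction q rule: poly_mapping_sum_induct)
    case (single m' c')
    then show ?case
      by (simp add: mult_single mpoly_eval_single hom_mult lookup_add power_add prod.distrib mult_ac)
  qed (simp add: mpoly_eval_add distrib_left)
qed (simp add: mpoly_eval_add distrib_right)

lemma mpoly_eval_mconst [simp]: "mpoly_eval h \<sigma> (mconst c) = h c"
  by (simp add: mconst_def mpoly_eval_single)

lemma mpoly_eval_pvar [simp]: "mpoly_eval h \<sigma> (pvar i) = \<sigma> i"
  by (simp add: pvar_def mpoly_eval_single lookup_single when_def hom_one if_distrib cong: if_cong)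

lemma mpoly_eval_one [simp]: "mpoly_eval h \<sigma> 1 = 1"
  using mpoly_eval_mconst[of \<sigma> 1] by (simp add: hom_one mconst.hom_one)

lemma mpoly_eval_zero [simp]: "mpoly_eval h \<sigma> 0 = 0"
  using mpoly_eval_mconst[of \<sigma> 0] by (simp add: hom_zero mconst.hom_zero)

lemma mpoly_eval_power: "mpoly_eval h \<sigma> (p ^ n) = mpoly_eval h \<sigma> p ^ n"
  by (induction n) (simp_all add: mpoly_eval_mult)

lemma mpoly_eval_uminus: "mpoly_eval h \<sigma> (- p) = - mpoly_eval h \<sigma> p"
  using mpoly_eval_add[of \<sigma> p "- p"] by (simp add: eq_neg_iff_add_eq_0 add.commute)

lemma mpoly_eval_diff: "mpoly_eval h \<sigma> (p - q) = mpoly_eval h \<sigma> p - mpoly_eval h \<sigma> q"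
  using mpoly_eval_add[of \<sigma> p "- q"] by (simp add: mpoly_eval_uminus)

lemma mpoly_eval_sum: "mpoly_eval h \<sigma> (\<Sum>i\<in>A. f i) = (\<Sum>i\<in>A. mpoly_eval h \<sigma> (f i))"
  by (induction A rule: infinite_finite_induct) (simp_all add: mpoly_eval_add)

lemma mpoly_eval_power_sum: "mpoly_eval h \<sigma> (power_sum k) = (\<Sum>i\<in>UNIV. \<sigma> i ^ k)"
  by (simp add: power_sum_def mpoly_eval_sum mpoly_eval_power)

lemmas mpoly_eval_simps = mpoly_eval_add mpoly_eval_mult mpoly_eval_power mpoly_eval_uminus
  mpoly_eval_diff mpoly_eval_power_sum

end

interpretation complex_id: complex_algebra "\<lambda>c. c"
  by unfold_locales simp_all

interpretation poly_mconst: complex_algebra "\<lambda>c. [:mconst c:]"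
proof
  show "[:mconst (c + d):] = [:mconst c:] + [:mconst d:]" for c d
    by (simp only: mconst.hom_add add_pCons add_0)
  show "[:mconst (c * d):] = [:mconst c:] * [:mconst d:]" for c d
    by (simp only: mconst.hom_mult mult_pCons_left mult_zero_left smult_pCons smult_0_right pCons_0_0 add_0_right)
  show "[:mconst 1:] = 1"
    by (simp only: mconst.hom_one one_pCons)
qed

text \<open>The polynomials that the substitution fixes modulo the ideal form a subalgebra, and by
  assumption it contains all variables.\<close>

lemma diff_mpoly_eval_mem_ideal_gen:
  assumes "\<And>i. pvar i - \<sigma> i \<in> ideal_gen S"
  shows "p - mpoly_eval mconst \<sigma> p \<in> ideal_gen S"
proof (induction p rule: mpoly_complex_induct)
  case (const c)
  show ?case
    using module.span_zero[OF module_times, of S] by (simp add: ideal_gen_def)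
next
  case (var i)
  with assms show ?case by simp
next
  case (add p q)
  then have "(p - mpoly_eval mconst \<sigma> p) + (q - mpoly_eval mconst \<sigma> q) \<in> ideal_gen S"
    by (rule ideal_gen_add)
  then show ?case
    by (simp add: mconst.mpoly_eval_add algebra_simps)
next
  case (mult p q)
  then have "q * (p - mpoly_eval mconst \<sigma> p) + mpoly_eval mconst \<sigma> p * (q - mpoly_eval mconst \<sigma> q) \<in> ideal_gen S"
    by (intro ideal_gen_add ideal_gen_mult)
  then show ?case
    by (simp add: mconst.mpoly_eval_mult algebra_simps)
qed

subsection \<open>Linear forms\<close>

context complex_algebra
begin

lemma mpoly_eval_ideal_gen:
  assumes "\<And>q. q \<in> S \<Longrightarrow> mpoly_eval h \<sigma> q = 0" and "p \<in> ideal_gen S"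
  shows "mpoly_eval h \<sigma> p = 0"
proof -
  have "module.subspace (*) {q. mpoly_eval h \<sigma> q = 0}"
    by (simp add: module.subspace_def[OF module_times] mpoly_eval_add mpoly_eval_mult)
  then have "ideal_gen S \<subseteq> {q. mpoly_eval h \<sigma> q = 0}"
    unfolding ideal_gen_def using assms(1) by (intro module.span_minimal[OF module_times]) auto
  with assms(2) show ?thesis by auto
qed

text \<open>This homogenizes the factorization of a monic polynomial in one variable.\<close>
lemma prod_mset_diff_hom_mult:
  "(\<Prod>r\<in>#A. x - h r * y) =
    (\<Sum>i\<le>size A. h (coeff (\<Prod>r\<in>#A. [:- r, 1:]) i) * x ^ i * y ^ (size A - i))"
proof (induction A)
  case empty
  show ?case by (simp add: hom_one)
next
  case (add r A)
  define p n where "p = (\<Prod>r\<in>#A. [:- r, 1:])" and "n = size A"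
  have "degree p \<le> n"
    unfolding p_def n_def
  proof (induction A)
    case (add r A)
    have "degree ([:- r, 1:] * (\<Prod>r\<in>#A. [:- r, 1:])) \<le> degree [:- r, 1:] + degree (\<Prod>r\<in>#A. [:- r, 1:])"
      by (rule degree_mult_le)
    with add show ?case by simp
  qed simp
  \<comment> \<open>With no term of degree \<open>Suc n\<close>, homogenizing \<open>p\<close> to
    degree \<open>Suc n\<close> instead of \<open>n\<close> only contributes a factor
    \<open>y\<close>.\<close>
  then have top: "coeff p (Suc n) = 0"
    by (simp add: coeff_eq_0)
  \<comment> \<open>\<open>F q m\<close> is the homogenization of \<open>q\<close> to degree
    \<open>m\<close>; the shift \<open>pCons 0\<close> becomes multiplication by
    \<open>x\<close>.\<close>
  define F where "F q m = (\<Sum>i\<le>m. h (coeff q i) * x ^ i * y ^ (m - i))" for q m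
  have "F (pCons 0 p) (Suc n) = x * F p n"
    unfolding F_def sum.atMost_Suc_shift sum_distrib_left by (simp add: mult_ac hom_zero)
  moreover have "F (smult (- r) p) (Suc n) = - (h r * y * F p n)"
  proof -
    have "F (smult (- r) p) (Suc n) = (\<Sum>i\<le>n. h (- r * coeff p i) * x ^ i * y ^ (Suc n - i))"
      by (simp add: F_def top hom_zero)
    also have "\<dots> = (\<Sum>i\<le>n. - (h r * y * (h (coeff p i) * x ^ i * y ^ (n - i))))"
    proof (rule sum.cong)
      fix i assume "i \<in> {..n}"
      then have "y ^ (Suc n - i) = y * y ^ (n - i)"
        by (simp add: Suc_diff_le)
      moreover have "h (- r * coeff p i) = - (h r * h (coeff p i))"
        by (simp only: mult_minus_left hom_uminus hom_mult)
      ultimately show "h (- r * coeff p i) * x ^ i * y ^ (Suc n - i) =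
          - (h r * y * (h (coeff p i) * x ^ i * y ^ (n - i)))"
        by (simp only: mult_minus_left mult_minus_right mult_ac)
    qed simp
    finally show ?thesis
      by (simp only: F_def sum_negf sum_distrib_left)
  qed
  moreover have "F ([:- r, 1:] * p) (Suc n) = F (smult (- r) p) (Suc n) + F (pCons 0 p) (Suc n)"
  proof -
    have "[:- r, 1:] * p = smult (- r) p + pCons 0 p"
      by simp
    then show ?thesis
      by (simp only: F_def coeff_add hom_add distrib_right sum.distrib)
  qed
  ultimately have "F ([:- r, 1:] * p) (Suc n) = (x - h r * y) * F p n"
    by (simp only: left_diff_distrib) simp
  moreover have "(\<Prod>r\<in>#A. x - h r * y) = F p n"
    unfolding F_def p_def n_def by (rule add)
  ultimately show ?case
    by (simp only: F_def p_def n_def image_mset_add_mset prod_mset.add_mset size_add_mset)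
qed

text \<open>The homogenized splitting of T^n - w over \<complex>. The roots form a multiset because
  \<open>w = 0\<close> is allowed and repeats the root \<open>0\<close>.\<close>

lemma binary_form_splits:
  assumes "n > 0"
  obtains A where "\<And>r. r \<in># A \<Longrightarrow> r ^ n = w"
    and "\<And>x y. x ^ n - h w * y ^ n = (\<Prod>r\<in>#A. x - h r * y)"
proof -
  define p where "p = monom 1 n + [:- w:]"
  have deg: "degree p = n"
    unfolding p_def using assms by (subst degree_add_eq_left) (simp_all add: degree_monom_eq)
  have lead: "lead_coeff p = 1"
    using assms unfolding deg by (simp add: p_def coeff_pCons split: nat.split)
  then have "p \<noteq> 0" by auto
  then obtain A where A: "size A = n" "p = (\<Prod>r\<in>#A. [:- r, 1:])"
    using alg_closed_imp_factorization[of p] lead deg by auto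
  show thesis
  proof
    fix r assume "r \<in># A"
    then have "poly p r = 0"
      unfolding A(2) by (auto simp: poly_prod_mset)
    then show "r ^ n = w"
      by (simp add: p_def poly_monom)
  next
    fix x y
    have "(\<Prod>r\<in>#A. x - h r * y) = (\<Sum>i\<le>n. h (coeff p i) * x ^ i * y ^ (n - i))"
      using prod_mset_diff_hom_mult[where x = x and y = y and A = A] A by simp
    also have "\<dots> = (\<Sum>i\<in>{0, n}. h (coeff p i) * x ^ i * y ^ (n - i))"
      by (rule sum.mono_neutral_right) (auto simp: p_def coeff_pCons hom_zero split: nat.split)
    also have "\<dots> = x ^ n - h w * y ^ n"
      using assms by (auto simp: p_def hom_uminus hom_one coeff_pCons split: nat.split)
    finally show "x ^ n - h w * y ^ n = (\<Prod>r\<in>#A. x - h r * y)" ..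
  qed
qed

end

lemma mem_ideal_gen_iff_mpoly_eval:
  assumes "\<And>q. q \<in> S \<Longrightarrow> mpoly_eval mconst \<sigma> q = 0" and "\<And>i. pvar i - \<sigma> i \<in> ideal_gen S"
  shows "p \<in> ideal_gen S \<longleftrightarrow> mpoly_eval mconst \<sigma> p = 0"
proof
  assume "mpoly_eval mconst \<sigma> p = 0"
  then show "p \<in> ideal_gen S"
    using diff_mpoly_eval_mem_ideal_gen[of \<sigma> S p] assms(2) by simp
qed (use assms(1) mconst.mpoly_eval_ideal_gen in blast)

text \<open>The ideal is the kernel of an endomorphism of a domain, hence prime. The sort
  \<open>linorder\<close> makes the polynomial ring a domain.\<close>

lemma nzd_mod_mpoly_eval:
  fixes f :: "'n::{finite, linorder} mpoly_complex"
  assumes "\<And>q. q \<in> S \<Longrightarrow> mpoly_eval mconst \<sigma> q = 0" and "\<And>i. pvar i - \<sigma> i \<in> ideal_gen S"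
    and "mpoly_eval mconst \<sigma> f \<noteq> 0"
  shows "nzd_mod S f"
  unfolding nzd_mod_def
  using assms(3) by (simp add: mem_ideal_gen_iff_mpoly_eval[OF assms(1,2)] mconst.mpoly_eval_mult)

lemma power_sum_3:
  assumes "(UNIV :: 3 set) = {i, j, k}" "distinct [i, j, k]"
  shows "(\<Sum>l\<in>UNIV. f l) = f i + f j + (f k :: 'a::comm_monoid_add)"
  unfolding assms(1) using assms(2) by (simp add: add.assoc)

text \<open>Modulo the linear form two variables remain, and in them \<open>power_sum a\<close> is a
  binary form that splits into linear factors. Modulo one of these a single variable remains, and
  \<open>power_sum c\<close> becomes a constant times its \<open>c\<close>-th power;
  \<open>root\<close> says that the constant is nonzero.\<close>

lemma weakly_regular_linear_form:
  fixes i j k :: 3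
  assumes ijk: "(UNIV :: 3 set) = {i, j, k}" "distinct [i, j, k]"
    and a: "a > 0"
    and root: "\<And>\<eta>. \<eta> ^ a = - (\<zeta> ^ a + 1) \<Longrightarrow> \<zeta> ^ c + 1 + \<eta> ^ c \<noteq> 0"
  shows "weakly_regular (power_sum a) (power_sum c) (pvar i - mconst \<zeta> * pvar j)"
proof -
  define L where "L = pvar i - mconst \<zeta> * pvar j"
  define \<sigma> where "\<sigma> = (\<lambda>l. if l = i then mconst \<zeta> * pvar j else pvar l)"
  note sum3 = power_sum_3[OF ijk]
  have neq: "i \<noteq> j" "i \<noteq> k" "j \<noteq> k" "j \<noteq> i" "k \<noteq> i" "k \<noteq> j"
    using ijk(2) by auto
  have \<sigma>L: "mpoly_eval mconst \<sigma> q = 0" if "q \<in> {L}" for q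
    using that neq by (auto simp: L_def \<sigma>_def mconst.mpoly_eval_simps)
  have L_mem: "pvar l - \<sigma> l \<in> ideal_gen {L}" for l
    by (simp add: mem_ideal_gen_singleton \<sigma>_def L_def)
  have nzd_L: "nzd_mod {L} f" if "mpoly_eval mconst \<sigma> f \<noteq> 0" for f
    by (rule nzd_mod_mpoly_eval[of "{L}" \<sigma>]) (use \<sigma>L L_mem that in blast)+
  have "L \<noteq> 0"
  proof
    assume "L = 0"
    then have "mpoly_eval (\<lambda>c. c) (\<lambda>l. if l = i then 1 else 0) L = 0"
      by simp
    then show False
      using neq by (simp add: L_def complex_id.mpoly_eval_simps)
  qed
  \<comment> \<open>Its value at the \<open>k\<close>-th unit vector is 1.\<close>
  have "mpoly_eval mconst \<sigma> (power_sum a) \<noteq> 0"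
  proof
    assume "mpoly_eval mconst \<sigma> (power_sum a) = 0"
    then have "mpoly_eval (\<lambda>c. c) (\<lambda>l. if l = k then 1 else 0) (mpoly_eval mconst \<sigma> (power_sum a)) = 0"
      by simp
    then show False
      using neq a by (simp add: mconst.mpoly_eval_power_sum sum3 \<sigma>_def complex_id.mpoly_eval_simps zero_power)
  qed
  then have "nzd_mod {L} (power_sum a)"
    by (rule nzd_L)
  then have 1: "nzd_mod {power_sum a} L"
    using \<open>L \<noteq> 0\<close> nzd_mod_swap by blast
  \<comment> \<open>Chosen so that \<open>power_sum a\<close> is congruent to
    \<open>pvar k ^ a - mconst w * pvar j ^ a\<close> modulo \<open>L\<close>. From here
    \<open>L\<close> comes first and \<open>power_sum a\<close> is the entry to be factored.\<close>
  define w where "w = - (\<zeta> ^ a + 1)"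
  obtain A where A: "\<And>r. r \<in># A \<Longrightarrow> r ^ a = w"
    "\<And>x y :: 3 mpoly_complex. x ^ a - mconst w * y ^ a = (\<Prod>r\<in>#A. x - mconst r * y)"
    using mconst.binary_form_splits[OF a] by metis
  have "weakly_regular L (power_sum c) (pvar k - mconst r * pvar j)" if "r \<in># A" for r
    unfolding weakly_regular_def
  proof
    have "mpoly_eval mconst \<sigma> (pvar k - mconst r * pvar j) \<noteq> 0"
    proof
      assume "mpoly_eval mconst \<sigma> (pvar k - mconst r * pvar j) = 0"
      then have "mpoly_eval (\<lambda>c. c) (\<lambda>l. if l = k then 1 else 0)
          (mpoly_eval mconst \<sigma> (pvar k - mconst r * pvar j)) = 0"
        by simp
      then show False
        using neq by (simp add: mconst.mpoly_eval_simps \<sigma>_def complex_id.mpoly_eval_simps)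
    qed
    then show "nzd_mod {L} (pvar k - mconst r * pvar j)"
      by (rule nzd_L)
    \<comment> \<open>Parametrizes the line where both linear forms vanish, spanned by the point
      with coordinates \<zeta>, 1, r at \<open>i\<close>, \<open>j\<close>,
      \<open>k\<close>.\<close>
    define \<tau> where "\<tau> = (\<lambda>l. if l = i then mconst \<zeta> * pvar j else if l = k then mconst r * pvar j else pvar j)"
    show "nzd_mod {L, pvar k - mconst r * pvar j} (power_sum c)"
    proof (rule nzd_mod_mpoly_eval)
      show "mpoly_eval mconst \<tau> q = 0" if "q \<in> {L, pvar k - mconst r * pvar j}" for q
        using that neq by (auto simp: L_def \<tau>_def mconst.mpoly_eval_simps)
      fix l
      have "l \<in> {i, j, k}" using ijk(1) by auto
      moreover have "L \<in> ideal_gen {L, M}" "M \<in> ideal_gen {L, M}" "0 \<in> ideal_gen {L, M}"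
        for M :: "3 mpoly_complex"
        using module.span_superset[OF module_times, of "{L, M}"] module.span_zero[OF module_times, of "{L, M}"]
        by (auto simp: ideal_gen_def)
      ultimately show "pvar l - \<tau> l \<in> ideal_gen {L, pvar k - mconst r * pvar j}"
        using neq by (auto simp: \<tau>_def L_def)
    next
      have "r ^ a = - (\<zeta> ^ a + 1)"
        using A(1)[OF that] by (simp add: w_def)
      then have "\<zeta> ^ c + 1 + r ^ c \<noteq> 0" by (rule root)
      show "mpoly_eval mconst \<tau> (power_sum c) \<noteq> 0"
      proof
        assume "mpoly_eval mconst \<tau> (power_sum c) = 0"
        then have "mpoly_eval (\<lambda>c. c) (\<lambda>l. 1) (mpoly_eval mconst \<tau> (power_sum c)) = 0"
          by simp
        then have "\<zeta> ^ c + 1 + r ^ c = 0"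
          using neq by (simp add: mconst.mpoly_eval_power_sum sum3 \<tau>_def complex_id.mpoly_eval_simps)
        with \<open>\<zeta> ^ c + 1 + r ^ c \<noteq> 0\<close> show False ..
      qed
    qed
  qed
  then have "weakly_regular L (power_sum c) (pvar k ^ a - mconst w * pvar j ^ a)"
    unfolding A(2) by (rule weakly_regular_prod_mset)
  then have "nzd_mod {L, pvar k ^ a - mconst w * pvar j ^ a} (power_sum c)"
    by (simp add: weakly_regular_def)
  moreover have "L dvd (pvar k ^ a - mconst w * pvar j ^ a) - power_sum a"
  proof -
    have "mpoly_eval mconst \<sigma> ((pvar k ^ a - mconst w * pvar j ^ a) - power_sum a) = 0"
      using neq by (simp add: mconst.mpoly_eval_simps sum3 \<sigma>_def w_def power_mult_distrib
          mconst.hom_power mconst.hom_diff mconst.hom_uminus mconst.hom_one algebra_simps)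
    then have "(pvar k ^ a - mconst w * pvar j ^ a) - power_sum a \<in> ideal_gen {L}"
      by (subst mem_ideal_gen_iff_mpoly_eval[OF \<sigma>L L_mem])
    then show ?thesis
      by (simp only: mem_ideal_gen_singleton)
  qed
  ultimately have "nzd_mod {L, power_sum a} (power_sum c)"
    by (rule nzd_mod_pair_cong[rotated])
  with 1 show ?thesis
    by (simp add: weakly_regular_def L_def insert_commute)
qed

subsection \<open>Power sums modulo a power sum\<close>

lemma weakly_regular_power_diff:
  fixes i j k :: 3
  assumes ijk: "(UNIV :: 3 set) = {i, j, k}" "distinct [i, j, k]"
    and a: "a > 0"
    and root: "\<And>\<zeta> \<eta>. \<zeta> ^ a = w \<Longrightarrow> \<eta> ^ a = - (w + 1) \<Longrightarrow> \<zeta> ^ c + 1 + \<eta> ^ c \<noteq> 0"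
  shows "weakly_regular (power_sum a) (power_sum c) (pvar i ^ a - mconst w * pvar j ^ a)"
proof -
  obtain A where A: "\<And>r. r \<in># A \<Longrightarrow> r ^ a = w"
    "\<And>x y :: 3 mpoly_complex. x ^ a - mconst w * y ^ a = (\<Prod>r\<in>#A. x - mconst r * y)"
    using mconst.binary_form_splits[OF a] by metis
  show ?thesis
    unfolding A(2)
  proof (rule weakly_regular_prod_mset)
    fix r assume "r \<in># A"
    with A(1) root show "weakly_regular (power_sum a) (power_sum c) (pvar i - mconst r * pvar j)"
      by (intro weakly_regular_linear_form[OF ijk a]) auto
  qed
qed

text \<open>A variable is the linear form with \<zeta> = 0, for which the condition on roots only
  concerns \<open>a\<close>-th roots of -1.\<close>

lemma weakly_regular_pvar:
  fixes i :: 3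
  assumes "a > 0" "c > 0"
    and root: "\<And>\<eta> :: complex. \<eta> ^ a = - 1 \<Longrightarrow> \<eta> ^ c \<noteq> - 1"
  shows "weakly_regular (power_sum a) (power_sum c) (pvar i)"
proof -
  have "card (UNIV - {i}) = 2"
    by (simp add: card_Diff_singleton)
  then obtain j k where jk: "UNIV - {i} = {j, k}" "j \<noteq> k"
    unfolding card_2_iff by blast
  then have "UNIV = {i, j, k}" "distinct [i, j, k]"
    by auto
  then have "weakly_regular (power_sum a) (power_sum c) (pvar i - mconst 0 * pvar j)"
    using assms by (intro weakly_regular_linear_form[where k = k]) (auto simp: zero_power add_eq_0_iff)
  then show ?thesis
    by (simp add: mconst.hom_zero)
qed

text \<open>Newton's identities modulo \<open>x + y + z\<close>, where the second elementary symmetric polynomial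
  becomes \<open>- (x\<^sup>2 + x * y + y\<^sup>2)\<close>.\<close>
lemma newton_mod_sum:
  fixes x y z :: "'a::comm_ring_1"
  defines "e \<equiv> x + y + z" and "q \<equiv> x\<^sup>2 + x * y + y\<^sup>2"
  shows "e dvd 2 * q - (x ^ 2 + y ^ 2 + z ^ 2)"
    and "e dvd 3 * (x * y * z) - (x ^ 3 + y ^ 3 + z ^ 3)"
    and "e dvd 2 * q ^ 2 - (x ^ 4 + y ^ 4 + z ^ 4)"
    and "e dvd 5 * (q * (x * y * z)) - (x ^ 5 + y ^ 5 + z ^ 5)"
    and "e dvd 7 * (q ^ 2 * (x * y * z)) - (x ^ 7 + y ^ 7 + z ^ 7)"
proof -
  define r where "r = x * y * z"
  define S where "S n = x ^ n + y ^ n + z ^ n" for n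
  have newton: "S (n + 3) = e * S (n + 2) - (x * y + y * z + z * x) * S (n + 1) + r * S n" for n
    by (simp add: S_def e_def r_def power_add power2_eq_square power3_eq_cube algebra_simps)
  have "e * (x + y) = q + (x * y + y * z + z * x)"
    by (simp add: e_def q_def power2_eq_square algebra_simps)
  then have e2: "x * y + y * z + z * x = e * (x + y) - q"
    by simp
  \<comment> \<open>Modulo \<open>e\<close>, Newton's recurrence loses its first term and reads
    \<open>S (n + 3) = q * S (n + 1) + r * S n\<close>.\<close>
  have step: "e dvd q * a + r * b - S (n + 3)" if "e dvd a - S (n + 1)" "e dvd b - S n" for a b n
  proof -
    have "q * a + r * b - S (n + 3) =
        q * (a - S (n + 1)) + r * (b - S n) + e * ((x + y) * S (n + 1) - S (n + 2))"
      unfolding newton e2 by (simp add: algebra_simps)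
    also have "e dvd \<dots>"
      by (intro dvd_add dvd_mult that dvd_triv_left)
    finally show ?thesis .
  qed
  have 0: "e dvd 3 - S 0" and 1: "e dvd 0 - S 1"
    by (simp_all add: S_def flip: e_def)
  have "2 * q - S 2 = e * (x + y - z)"
    by (simp add: S_def e_def q_def power2_eq_square algebra_simps)
  then have 2: "e dvd 2 * q - S 2"
    by simp
  have 3: "e dvd q * 0 + r * 3 - S 3"
    using step[of 0 0 3] 0 1 by simp
  have 4: "e dvd q * (2 * q) + r * 0 - S 4"
    using step[of "2 * q" 1 0] 1 2 by (simp add: numeral_eq_Suc)
  have 5: "e dvd q * (q * 0 + r * 3) + r * (2 * q) - S 5"
    using step[of "q * 0 + r * 3" 2 "2 * q"] 2 3 by simp
  \<comment> \<open>Built from \<open>S 5\<close> and \<open>S 4\<close>. The skipped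
    \<open>S 6\<close> would be \<open>2 * q ^ 3 + 3 * r ^ 2\<close> modulo \<open>e\<close>, which
    is not a monomial in \<open>q\<close> and \<open>r\<close>.\<close>
  have 7: "e dvd q * (q * (q * 0 + r * 3) + r * (2 * q)) + r * (q * (2 * q) + r * 0) - S 7"
    using step[of "q * (q * 0 + r * 3) + r * (2 * q)" 4 "q * (2 * q) + r * 0"] 4 5 by simp
  have "q * 0 + r * 3 = 3 * r" "q * (2 * q) + r * 0 = 2 * q ^ 2"
    "q * (q * 0 + r * 3) + r * (2 * q) = 5 * (q * r)"
    "q * (q * (q * 0 + r * 3) + r * (2 * q)) + r * (q * (2 * q) + r * 0) = 7 * (q ^ 2 * r)"
    by (simp_all add: power2_eq_square algebra_simps)
  with 2 3 4 5 7 show "e dvd 2 * q - (x ^ 2 + y ^ 2 + z ^ 2)"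
    and "e dvd 3 * (x * y * z) - (x ^ 3 + y ^ 3 + z ^ 3)"
    and "e dvd 2 * q ^ 2 - (x ^ 4 + y ^ 4 + z ^ 4)"
    and "e dvd 5 * (q * (x * y * z)) - (x ^ 5 + y ^ 5 + z ^ 5)"
    and "e dvd 7 * (q ^ 2 * (x * y * z)) - (x ^ 7 + y ^ 7 + z ^ 7)"
    unfolding S_def r_def by argo+
qed

lemma UNIV_3: "(UNIV :: 3 set) = {0, 1, 2}" "distinct [0, 1, 2 :: 3]"
proof -
  show "distinct [0, 1, 2 :: 3]" by simp
  then have "card {0, 1, 2 :: 3} = card (UNIV :: 3 set)"
    by simp
  then show "(UNIV :: 3 set) = {0, 1, 2}"
    by (metis card_subset_eq finite subset_UNIV)
qed

lemma power_sum_3_eq: "power_sum k = pvar 0 ^ k + pvar 1 ^ k + (pvar 2 ^ k :: 3 mpoly_complex)"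
  by (simp add: power_sum_def power_sum_3[OF UNIV_3])

text \<open>The monomial for \<open>t\<close> contains the variables only for odd \<open>t\<close>
  and the factor \<open>q\<close> only for \<open>t \<noteq> 3\<close>; this explains the guards.
  \<open>root2\<close> treats the variables, \<open>root3\<close> the linear factors of
  \<open>q\<close>.\<close>

lemma weakly_regular_power_sum:
  assumes "a > 0" "c > 0" and t: "t \<in> {2, 3, 4, 5, 7}"
    and root2: "\<And>\<eta> :: complex. odd t \<Longrightarrow> \<eta> ^ a = - 1 \<Longrightarrow> \<eta> ^ c \<noteq> - 1"
    and root3: "\<And>w \<zeta> \<eta> :: complex. t \<noteq> 3 \<Longrightarrow> w\<^sup>2 + w + 1 = 0 \<Longrightarrow> \<zeta> ^ a = w \<Longrightarrow> \<eta> ^ a = - (w + 1) \<Longrightarrow>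
      \<zeta> ^ c + 1 + \<eta> ^ c \<noteq> 0"
  shows "weakly_regular (power_sum a) (power_sum c) (power_sum (a * t) :: 3 mpoly_complex)"
proof -
  define x y z :: "3 mpoly_complex" where "x = pvar 0 ^ a" and "y = pvar 1 ^ a" and "z = pvar 2 ^ a"
  define q where "q = x\<^sup>2 + x * y + y\<^sup>2"
  let ?W = "weakly_regular (power_sum a) (power_sum c :: 3 mpoly_complex)"
  have xyz: "?W (x * y * z)" if "odd t"
    unfolding x_def y_def z_def using that assms(1,2) root2
    by (intro weakly_regular_mult weakly_regular_power weakly_regular_pvar)
  have q: "?W q" if "t \<noteq> 3"
  proof -
    \<comment> \<open>\<open>w\<close> and \<open>- w - 1\<close> are the two primitive cube roots
      of unity, and \<open>q\<close> is the product of the corresponding factors.\<close>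
    define w where "w = Complex (- 1 / 2) (sqrt 3 / 2)"
    have w: "w\<^sup>2 + w + 1 = 0"
      by (simp add: w_def complex_eq_iff power2_eq_square)
    then have "(- w - 1)\<^sup>2 + (- w - 1) + 1 = 0"
      by (simp add: power2_eq_square algebra_simps)
    moreover have "?W (x - mconst w * y)" if "w\<^sup>2 + w + 1 = 0" for w
      unfolding x_def y_def
      using root3[OF \<open>t \<noteq> 3\<close> that] by (intro weakly_regular_power_diff[OF UNIV_3 assms(1)]) blast
    ultimately have "?W (x - mconst w * y)" "?W (x - mconst (- w - 1) * y)"
      using w by blast+
    then have "?W ((x - mconst w * y) * (x - mconst (- w - 1) * y))"
      by (rule weakly_regular_mult)
    also have "(x - mconst w * y) * (x - mconst (- w - 1) * y) =
        x\<^sup>2 + x * y - mconst w * (mconst w + 1) * y\<^sup>2"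
      by (simp add: mconst.hom_diff mconst.hom_uminus mconst.hom_one power2_eq_square algebra_simps)
    also have "mconst w * (mconst w + 1) = (mconst (w * (w + 1)) :: 3 mpoly_complex)"
      by (simp add: mconst.hom_mult mconst.hom_add mconst.hom_one)
    also have "w * (w + 1) = - 1"
      using w by (simp add: power2_eq_square algebra_simps eq_neg_iff_add_eq_0)
    finally show ?thesis
      by (simp add: q_def mconst.hom_uminus mconst.hom_one)
  qed
  have num: "?W (numeral n)" for n
  proof (rule weakly_regular_unit)
    have "mconst (numeral n) dvd (1 :: 3 mpoly_complex)"
      by (rule mconst.hom_unit) simp
    then show "(numeral n :: 3 mpoly_complex) dvd 1"
      by (simp add: mconst_def)
  qed
  have e: "power_sum a = x + y + z"
    by (simp add: power_sum_3_eq x_def y_def z_def)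
  have pt: "power_sum (a * t) = x ^ t + y ^ t + z ^ t"
    by (simp add: power_sum_3_eq x_def y_def z_def power_mult)
  note newton = newton_mod_sum[of x y z, folded e q_def]
  note intros = weakly_regular_mult weakly_regular_power num xyz q
  consider "t = 2" | "t = 3" | "t = 4" | "t = 5" | "t = 7"
    using t by auto
  then show ?thesis
    unfolding pt
  proof cases
    case 1
    then show "?W (x ^ t + y ^ t + z ^ t)"
      using newton(1) by (auto elim!: weakly_regular_cong intro!: intros)
  next
    case 2
    then show "?W (x ^ t + y ^ t + z ^ t)"
      using newton(2) by (auto elim!: weakly_regular_cong intro!: weakly_regular_mult[OF num xyz])
  next
    case 3
    then show "?W (x ^ t + y ^ t + z ^ t)"
      using newton(3) by (auto elim!: weakly_regular_cong intro!: intros)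
  next
    case 4
    then show "?W (x ^ t + y ^ t + z ^ t)"
      using newton(4) by (auto elim!: weakly_regular_cong intro!: weakly_regular_mult[OF num weakly_regular_mult[OF q xyz]])
  next
    case 5
    then show "?W (x ^ t + y ^ t + z ^ t)"
      using newton(5) by (auto elim!: weakly_regular_cong intro!: weakly_regular_mult[OF num weakly_regular_mult[OF weakly_regular_power[OF q] xyz]])
  qed
qed

subsection \<open>Common zeros\<close>

lemma cube_root_power_3:
  fixes w :: complex
  assumes "w\<^sup>2 + w + 1 = 0"
  shows "w ^ 3 = 1"
proof -
  have "w ^ 3 - 1 = (w - 1) * (w\<^sup>2 + w + 1)"
    by (simp add: power2_eq_square power3_eq_cube algebra_simps)
  with assms show ?thesis by simp
qed

lemma norm_eq_1_if_power_eq_cube_root: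
  fixes \<zeta> w :: complex
  assumes "a > 0" "w\<^sup>2 + w + 1 = 0" "\<zeta> ^ a = w"
  shows "norm \<zeta> = 1"
proof -
  have "w ^ 3 = 1"
    using assms(2) by (rule cube_root_power_3)
  then have "\<zeta> ^ (a * 3) = 1"
    using assms(3) by (simp add: power_mult)
  then show ?thesis
    using assms(1) power_eq_1_iff[of \<zeta> "a * 3"] by simp
qed

text \<open>Three unit vectors with sum zero form an equilateral triangle. Conjugation inverts on
  the unit circle, so the conjugated equation is a second one, and \<beta> can be
  eliminated.\<close>

lemma cube_root_if_sum_eq_0:
  fixes \<alpha> \<beta> :: complex
  assumes "\<alpha> + 1 + \<beta> = 0" "norm \<alpha> = 1" "norm \<beta> = 1"
  shows "\<alpha>\<^sup>2 + \<alpha> + 1 = 0"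
proof -
  have unit: "\<alpha> * cnj \<alpha> = 1" "\<beta> * cnj \<beta> = 1"
    using assms(2,3) by (simp_all add: complex_norm_square[symmetric])
  have "cnj \<alpha> + 1 + cnj \<beta> = 0"
    using arg_cong[OF assms(1), of cnj] by simp
  then have "\<alpha> * \<beta> * (cnj \<alpha> + 1 + cnj \<beta>) = 0"
    by simp
  then have "\<beta> * (\<alpha> * cnj \<alpha>) + \<alpha> * \<beta> + \<alpha> * (\<beta> * cnj \<beta>) = 0"
    by (simp add: distrib_left mult_ac)
  then have "\<beta> + \<alpha> * \<beta> + \<alpha> = 0"
    by (simp add: unit)
  moreover have "\<beta> = - 1 - \<alpha>"
    using assms(1) by (simp add: eq_neg_iff_add_eq_0 eq_diff_eq add_ac)
  ultimately have "(- 1 - \<alpha>) + \<alpha> * (- 1 - \<alpha>) + \<alpha> = 0"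
    by simp
  also have "(- 1 - \<alpha>) + \<alpha> * (- 1 - \<alpha>) + \<alpha> = - (\<alpha>\<^sup>2 + \<alpha> + 1)"
    by (simp add: power2_eq_square algebra_simps)
  finally show ?thesis
    by (simp only: neg_equal_0_iff_equal)
qed

lemma cube_root_power_eq_1_iff:
  fixes w :: complex
  assumes "w\<^sup>2 + w + 1 = 0"
  shows "w ^ n = 1 \<longleftrightarrow> 3 dvd n"
proof -
  have w3: "w ^ 3 = 1"
    using assms by (rule cube_root_power_3)
  have n0: "w \<noteq> 1"
    using assms by auto
  have n2: "w\<^sup>2 \<noteq> 1"
  proof
    assume "w\<^sup>2 = 1"
    then have "w ^ 3 = w"
      by (simp add: power3_eq_cube power2_eq_square)
    with w3 n0 show False by simp
  qed
  have "w ^ n = (w ^ 3) ^ (n div 3) * w ^ (n mod 3)"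
    by (simp only: power_mult[symmetric] power_add[symmetric] mult_div_mod_eq)
  then have n: "w ^ n = w ^ (n mod 3)"
    by (simp only: w3 power_one mult_1)
  have "n mod 3 < 3" by simp
  then consider "n mod 3 = 0" | "n mod 3 = 1" | "n mod 3 = 2"
    by linarith
  then show ?thesis
    by cases (simp_all only: n dvd_eq_mod_eq_0 power_0 power_one_right n0 n2, simp_all)
qed

text \<open>Computing \<open>\<eta> ^ (a * c)\<close> in two ways shows that \<open>a\<close> and
  \<open>c\<close> have the same parity.\<close>

lemma no_common_zero_odd:
  fixes \<eta> :: complex
  assumes "coprime a c" "even (a * c)" "\<eta> ^ a = - 1"
  shows "\<eta> ^ c \<noteq> - 1"
proof
  assume "\<eta> ^ c = - 1"
  then have "(- 1 :: complex) ^ c = (- 1) ^ a"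
    by (metis assms(3) power_mult mult.commute)
  then have "even a \<longleftrightarrow> even c"
    by (simp add: uminus_power_if split: if_splits)
  with assms(2) have "even a" "even c" by auto
  with assms(1) show False
    by (meson coprime_common_divisor odd_one)
qed

text \<open>A zero sum would make \<open>\<zeta> ^ c\<close> a primitive cube root of unity like
  \<open>w\<close>. Comparing \<open>(\<zeta> ^ c) ^ a\<close> with \<open>w ^ c\<close> then shows
  that 3 divides both or neither of \<open>a\<close> and \<open>c\<close>.\<close>

lemma no_common_zero_cube_root:
  fixes w \<zeta> \<eta> :: complex
  assumes "a > 0" "c > 0" "coprime a c" "3 dvd a * c"
    and w: "w\<^sup>2 + w + 1 = 0" and z: "\<zeta> ^ a = w" "\<eta> ^ a = - (w + 1)"
  shows "\<zeta> ^ c + 1 + \<eta> ^ c \<noteq> 0"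
proof
  assume eq: "\<zeta> ^ c + 1 + \<eta> ^ c = 0"
  have w': "(- (w + 1))\<^sup>2 + - (w + 1) + 1 = 0"
    using w by (simp add: power2_eq_square algebra_simps)
  have "norm (\<zeta> ^ c) = 1" "norm (\<eta> ^ c) = 1"
    using norm_eq_1_if_power_eq_cube_root[OF assms(1) w z(1)]
      norm_eq_1_if_power_eq_cube_root[OF assms(1) w' z(2)] by (simp_all add: norm_power)
  then have c: "(\<zeta> ^ c)\<^sup>2 + \<zeta> ^ c + 1 = 0"
    using eq by (intro cube_root_if_sum_eq_0)
  have "(\<zeta> ^ c) ^ a = w ^ c"
    using z(1) by (metis power_mult mult.commute)
  then have "3 dvd a \<longleftrightarrow> 3 dvd c"
    using cube_root_power_eq_1_iff[OF c] cube_root_power_eq_1_iff[OF w] by metis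
  moreover have "3 dvd a \<or> 3 dvd c"
    using assms(4) by (simp add: prime_dvd_mult_iff)
  ultimately have "is_unit (3::nat)"
    using assms(3) by (meson coprime_common_divisor)
  then show False by simp
qed

subsection \<open>Permuting the sequence\<close>

text \<open>The degree in the auxiliary variable \<open>T\<close> records the grading.\<close>
definition grade :: "'n::finite mpoly_complex \<Rightarrow> 'n mpoly_complex poly"
  where "grade = mpoly_eval (\<lambda>c. [:mconst c:]) (\<lambda>i. [:0, pvar i:])"

lemma poly_grade_1: "poly (grade p) 1 = p"
  by (induction p rule: mpoly_complex_induct)
    (simp_all add: grade_def poly_mconst.mpoly_eval_add poly_mconst.mpoly_eval_mult)

lemma grade_power_sum: "grade (power_sum k :: 'n::finite mpoly_complex) = monom (power_sum k) k"
proof -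
  have "[:0, pvar i :: 'n mpoly_complex:] ^ k = monom (pvar i ^ k) k" for i :: 'n
  proof -
    have "[:0, pvar i:] = monom (pvar i) 1"
      by (simp add: monom_Suc monom_0)
    then show ?thesis
      by (simp add: monom_power)
  qed
  then have "grade (power_sum k :: 'n mpoly_complex) = (\<Sum>i\<in>UNIV. monom (pvar i ^ k) k)"
    by (simp add: grade_def poly_mconst.mpoly_eval_power_sum)
  also have "\<dots> = monom (power_sum k) k"
    by (simp add: power_sum_def monom_sum)
  finally show ?thesis .
qed

text \<open>Each round cancels \<open>h\<close> modulo \<open>{f, g}\<close> to write
  \<open>k\<close> as \<open>r * f + s * g\<close>, then cancels \<open>g\<close> modulo
  \<open>f\<close>, so that \<open>s\<close> inherits the property of \<open>k\<close>.\<close>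

lemma nzd_mod_descent:
  assumes "nzd_mod {f} g" "nzd_mod {f, g} h" "f dvd m * h"
  shows "\<exists>k l. m = k * g ^ n + l * f \<and> f dvd k * h"
proof (induction n)
  case 0
  show ?case
    by (rule exI[of _ m], rule exI[of _ 0]) (simp add: assms(3))
next
  case (Suc n)
  then obtain k l where kl: "m = k * g ^ n + l * f" "f dvd k * h"
    by blast
  then obtain u where "k * h = f * u"
    by (elim dvdE)
  then have "k * h = u * f + 0 * g"
    by (simp add: mult.commute)
  then have "k * h \<in> ideal_gen {f, g}"
    unfolding mem_ideal_gen_pair by blast
  then have "k \<in> ideal_gen {f, g}"
    using assms(2) by (rule nzd_modD[rotated])
  then obtain r s where rs: "k = r * f + s * g"
    by (auto simp: mem_ideal_gen_pair)
  have "f dvd k * h - f * (r * h)"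
    using kl(2) by (intro dvd_diff) simp_all
  then have "f dvd (s * h) * g"
    by (simp add: rs algebra_simps)
  then have "f dvd s * h"
    using assms(1) by (rule nzd_mod_singletonD[rotated])
  moreover have "m = s * g ^ Suc n + (r * g ^ n + l) * f"
    by (simp add: kl(1) rs algebra_simps)
  ultimately show ?case by blast
qed

text \<open>Homogeneity enters here: without it, regular sequences cannot be permuted.\<close>
lemma nzd_mod_power_sum:
  fixes h :: "'n::finite mpoly_complex"
  assumes "b > 0" "nzd_mod {power_sum a} (power_sum b :: 'n mpoly_complex)"
    and "nzd_mod {power_sum a, power_sum b} h"
  shows "nzd_mod {power_sum a} h"
  unfolding nzd_mod_def mem_ideal_gen_singleton
proof (intro allI impI)
  fix m :: "'n mpoly_complex" assume dv: "power_sum a dvd m * h"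
  \<comment> \<open>Large enough that \<open>power_sum b ^ n\<close> contributes only in degrees
    above that of \<open>m\<close>, so every homogeneous component of \<open>m\<close> comes from
    the multiple of \<open>power_sum a\<close>.\<close>
  define n where "n = Suc (degree (grade m))"
  obtain k l where m: "m = k * power_sum b ^ n + l * power_sum a"
    using nzd_mod_descent[OF assms(2,3) dv] by blast
  have grade_m: "grade m = monom (power_sum b ^ n) (b * n) * grade k + monom (power_sum a) a * grade l"
    unfolding m grade_def poly_mconst.mpoly_eval_add poly_mconst.mpoly_eval_mult poly_mconst.mpoly_eval_power
    by (simp add: grade_power_sum monom_power mult.commute flip: grade_def)
  have "power_sum a dvd coeff (grade m) j" if "j \<le> degree (grade m)" for j
  proof -
    have "j < n" using that by (simp add: n_def)
    also have "n \<le> b * n" using assms(1) by simp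
    finally show ?thesis
      by (simp add: grade_m coeff_monom_mult)
  qed
  then have "power_sum a dvd poly (grade m) 1"
    unfolding poly_altdef by (intro dvd_sum) auto
  then show "power_sum a dvd m"
    by (simp only: poly_grade_1)
qed

text \<open>The argument of \<open>nzd_mod_swap\<close>, carried out modulo
  \<open>f\<close>.\<close>

lemma nzd_mod_pair_swap:
  assumes "nzd_mod {f} g" "nzd_mod {f, g} h"
  shows "nzd_mod {f, h} g"
  unfolding nzd_mod_def
proof (intro allI impI)
  fix m assume "m * g \<in> ideal_gen {f, h}"
  then obtain u v where uv: "m * g = u * f + v * h"
    by (auto simp: mem_ideal_gen_pair)
  then have "v * h = (- u) * f + m * g"
    by simp
  then have "v \<in> ideal_gen {f, g}"
    using assms(2) unfolding nzd_mod_def mem_ideal_gen_pair by blast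
  then obtain r s where rs: "v = r * f + s * g"
    by (auto simp: mem_ideal_gen_pair)
  have "(m - s * h) * g = f * (u + r * h)"
    using uv by (simp add: rs algebra_simps)
  then have "f dvd m - s * h"
    using assms(1) by (metis dvd_triv_left nzd_mod_singletonD)
  then obtain k where "m - s * h = f * k" ..
  then have "m = k * f + s * h"
    by (simp add: algebra_simps)
  then show "m \<in> ideal_gen {f, h}"
    unfolding mem_ideal_gen_pair by blast
qed

lemma power_sum_neq_0: "(power_sum k :: 'n::finite mpoly_complex) \<noteq> 0"
proof
  assume "(power_sum k :: 'n mpoly_complex) = 0"
  then have "mpoly_eval (\<lambda>c. c) (\<lambda>_. 1) (power_sum k :: 'n mpoly_complex) = 0"
    by simp
  then show False
    by (simp add: complex_id.mpoly_eval_power_sum)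
qed

text \<open>All generators vanish at the origin.\<close>

lemma one_notin_ideal_gen_power_sum:
  assumes "\<And>q. q \<in> S \<Longrightarrow> \<exists>k>0. q = power_sum k"
  shows "(1 :: 'n::finite mpoly_complex) \<notin> ideal_gen S"
proof
  assume 1: "1 \<in> ideal_gen S"
  have "mpoly_eval (\<lambda>c. c) (\<lambda>_. 0) q = 0" if "q \<in> S" for q
  proof -
    obtain k where "k > 0" "q = power_sum k"
      using assms \<open>q \<in> S\<close> by blast
    then show ?thesis
      by (simp add: complex_id.mpoly_eval_power_sum)
  qed
  then have "mpoly_eval (\<lambda>c. c) (\<lambda>_. 0) (1 :: 'n mpoly_complex) = 0"
    using 1 by (rule complex_id.mpoly_eval_ideal_gen)
  then show False
    by simp
qed

lemma regular_sequence_power_sum: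
  fixes a b c :: nat
  assumes "a > 0" "b > 0" "c > 0"
    and "weakly_regular (power_sum a) (power_sum c) (power_sum b :: 'n::{finite, linorder} mpoly_complex)"
  shows "regular_sequence [power_sum a, power_sum b, power_sum c :: 'n mpoly_complex]"
    and "regular_sequence [power_sum a, power_sum c, power_sum b :: 'n mpoly_complex]"
    and "regular_sequence [power_sum c, power_sum a, power_sum b :: 'n mpoly_complex]"
proof -
  let ?p = "power_sum :: nat \<Rightarrow> 'n mpoly_complex"
  have ab: "nzd_mod {?p a} (?p b)" and abc: "nzd_mod {?p a, ?p b} (?p c)"
    using assms(4) by (simp_all add: weakly_regular_def)
  \<comment> \<open>The one step that uses homogeneity; the other orders follow by exchanging
    neighbours.\<close>
  have ac: "nzd_mod {?p a} (?p c)"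
    using assms(2) ab abc by (rule nzd_mod_power_sum)
  have ca: "nzd_mod {?p c} (?p a)"
    using power_sum_neq_0 ac by (rule nzd_mod_swap)
  have acb: "nzd_mod {?p a, ?p c} (?p b)"
    using ab abc by (rule nzd_mod_pair_swap)
  then have cab: "nzd_mod {?p c, ?p a} (?p b)"
    by (simp add: insert_commute)
  have zero: "nzd_mod {} (?p k)" for k
    by (rule nzd_mod_empty) (rule power_sum_neq_0)
  have one: "1 \<notin> ideal_gen {?p i, ?p j, ?p k}" if "{i, j, k} \<subseteq> {a, b, c}" for i j k
    using that assms(1-3) by (intro one_notin_ideal_gen_power_sum) auto
  show "regular_sequence [?p a, ?p b, ?p c]" "regular_sequence [?p a, ?p c, ?p b]"
    "regular_sequence [?p c, ?p a, ?p b]"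
    unfolding regular_sequence_3 using ab abc ac ca acb cab zero one by auto
qed

subsection \<open>Ideals with two generators\<close>

interpretation poly_const: complex_algebra "\<lambda>c. [:c:]"
  by unfold_locales (simp_all add: one_pCons)

text \<open>Write \<open>f = a * u + b * v\<close> and \<open>g = c * u + d * v\<close>. By Cramer's rule \<open>a * d - b * c\<close> multiplies
  the ideal of \<open>u\<close> and \<open>v\<close> into that of \<open>f\<close> and \<open>g\<close>, so regularity forces it into the latter.\<close>
lemma regular_sequence_cramer:
  assumes reg: "regular_sequence [f, g, h]"
    and f: "f = a * u + b * v" and g: "g = c * u + d * v" and h: "h \<in> ideal_gen {u, v}"
  obtains k where "u dvd d * (1 - k * v)"
proof -
  from reg have f0: "nzd_mod {} f" and g1: "nzd_mod {f} g" and h2: "nzd_mod {f, g} h"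
    by (simp_all add: regular_sequence_3)
  define D where "D = a * d - b * c"
  obtain r s where h: "h = r * u + s * v"
    using h by (auto simp: mem_ideal_gen_pair)
  have "D * h = (r * d - s * c) * f + (s * a - r * b) * g"
    by (simp add: D_def f g h algebra_simps)
  then have "D \<in> ideal_gen {f, g}"
    using h2 unfolding nzd_mod_def mem_ideal_gen_pair by blast
  then obtain \<alpha> \<beta> where D: "D = \<alpha> * f + \<beta> * g"
    by (auto simp: mem_ideal_gen_pair)
  have "D * u = d * f - b * g"
    by (simp add: D_def f g algebra_simps)
  \<comment> \<open>A relation between \<open>f\<close> and \<open>g\<close>, which regularity makes
    a multiple, with factor \<open>k\<close>, of the trivial one.\<close>
  then have rel: "(\<beta> * u + b) * g = f * (d - \<alpha> * u)"
    unfolding D by (simp add: algebra_simps)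
  then have "f dvd \<beta> * u + b"
    using g1 by (metis dvd_triv_left nzd_mod_singletonD)
  then obtain k where k: "\<beta> * u + b = f * k" ..
  have "(d - \<alpha> * u - k * g) * f = 0"
    using rel unfolding k by (simp add: algebra_simps)
  then have "d - \<alpha> * u - k * g = 0"
    using f0 unfolding nzd_mod_def mem_ideal_gen_empty by blast
  then have "d - \<alpha> * u - k * (c * u + d * v) = 0"
    by (simp only: g)
  then have "d * (1 - k * v) = u * (\<alpha> + k * c)"
    by (simp add: algebra_simps)
  then show thesis
    using that by (metis dvd_triv_left)
qed

text \<open>\<sigma> is a parametrized curve on which \<open>u\<close> vanishes, with
  \<open>v\<close> vanishing at parameter 0. Along it the divisibility from
  \<open>regular_sequence_cramer\<close> reads \<open>ev d * (1 - ev k * ev v) = 0\<close>. As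
  \<open>ev g = ev d * ev v\<close> is nonzero, \<open>ev k * ev v\<close> must be 1, which fails at
  0.\<close>

lemma not_regular_sequence_if_common_zero:
  fixes \<sigma> :: "'n::finite \<Rightarrow> complex poly"
  defines "ev \<equiv> mpoly_eval (\<lambda>c. [:c:]) \<sigma>"
  assumes "f \<in> ideal_gen {u, v}" "g \<in> ideal_gen {u, v}" "h \<in> ideal_gen {u, v}"
    and u: "ev u = 0" and v: "poly (ev v) 0 = 0" and g: "ev g \<noteq> 0"
  shows "\<not> regular_sequence [f, g, h]"
proof
  assume reg: "regular_sequence [f, g, h]"
  obtain a b c d where fg: "f = a * u + b * v" "g = c * u + d * v"
    using assms(2,3) by (auto simp: mem_ideal_gen_pair)
  obtain k where "u dvd d * (1 - k * v)"
    using regular_sequence_cramer[OF reg fg assms(4)] .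
  then obtain l where "d * (1 - k * v) = u * l" ..
  then have "ev d * (1 - ev k * ev v) = ev u * ev l"
    unfolding ev_def by (metis poly_const.mpoly_eval_mult poly_const.mpoly_eval_diff poly_const.mpoly_eval_one)
  moreover have "ev d \<noteq> 0"
    using g u unfolding fg(2) ev_def by (auto simp: poly_const.mpoly_eval_add poly_const.mpoly_eval_mult)
  ultimately have "1 - ev k * ev v = 0"
    using u by simp
  then have "poly (1 - ev k * ev v) 0 = 0"
    by simp
  with v show False by simp
qed

section \<open>Power sums in the two obstructing ideals\<close>

lemma sum_dvd_odd_power_sum: "odd k \<Longrightarrow> x + y dvd x ^ k + (y ^ k :: 'a::comm_ring_1)"
proof (induction k rule: nat_less_induct)
  case (1 k)
  show ?case
  proof (cases "k < 2")
    case True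
    then show ?thesis using \<open>odd k\<close> by (cases k) auto
  next
    case False
    then obtain m where k: "k = m + 2"
      by (metis add.commute le_Suc_ex linorder_not_less)
    then have "x + y dvd x ^ m + y ^ m"
      using 1 by simp
    \<comment> \<open>The linear recurrence with characteristic roots \<open>x\<close> and
      \<open>y\<close>.\<close>
    then have "x + y dvd (x + y) * (x ^ Suc m + y ^ Suc m) - x * y * (x ^ m + y ^ m)"
      by (intro dvd_diff dvd_mult dvd_triv_left)
    also have "(x + y) * (x ^ Suc m + y ^ Suc m) - x * y * (x ^ m + y ^ m) = x ^ k + y ^ k"
      by (simp add: k algebra_simps)
    finally show ?thesis .
  qed
qed

lemma power_sum_mem_odd:
  assumes "odd k"
  shows "power_sum k \<in> ideal_gen {pvar 0 + pvar 1, pvar 2 :: 3 mpoly_complex}"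
proof -
  obtain r where r: "pvar 0 ^ k + pvar 1 ^ k = (pvar 0 + pvar 1) * (r :: 3 mpoly_complex)"
    using sum_dvd_odd_power_sum[OF assms, of "pvar 0" "pvar 1 :: 3 mpoly_complex"] by (rule dvdE)
  obtain m where m: "k = Suc m"
    using assms by (cases k) auto
  have "power_sum k = r * (pvar 0 + pvar 1) + pvar 2 ^ m * (pvar 2 :: 3 mpoly_complex)"
    unfolding power_sum_3_eq r by (simp add: m mult.commute)
  then show ?thesis
    unfolding mem_ideal_gen_pair by blast
qed

text \<open>Modulo the ideal Newton's recurrence is \<open>S (n + 3) = x * y * z * S n\<close>, so
  only the exponents 1 and 2 need checking.\<close>

lemma power_sum_mem_not_dvd_3:
  fixes x y z :: "'a::comm_ring_1"
  defines "I \<equiv> ideal_gen {x + y + z, x * y + y * z + z * x}"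
  assumes "\<not> 3 dvd k"
  shows "x ^ k + y ^ k + z ^ k \<in> I"
  using assms(2)
proof (induction k rule: nat_less_induct)
  case (1 k)
  let ?S = "\<lambda>n. x ^ n + y ^ n + z ^ n"
  have gen: "r * (x + y + z) + s * (x * y + y * z + z * x) \<in> I" for r s
    unfolding I_def mem_ideal_gen_pair by blast
  have "k \<noteq> 0"
    using 1(2) by (cases k) auto
  then consider "k = 1" | "k = 2" | "k \<ge> 3"
    by linarith
  then show ?case
  proof cases
    case 1
    then show ?thesis using gen[of 1 0] by simp
  next
    case 2
    have "?S 2 = (x + y + z) * (x + y + z) + (- 2) * (x * y + y * z + z * x)"
      by (simp add: power2_eq_square algebra_simps)
    then show ?thesis using gen 2 by metis
  next
    case 3
    then obtain n where k: "k = n + 3"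
      by (metis add.commute le_Suc_ex)
    then have "?S n \<in> I"
      using 1 by (simp add: dvd_add_left_iff)
    then have "?S (n + 2) * (x + y + z) + (- ?S (n + 1)) * (x * y + y * z + z * x) + x * y * z * ?S n \<in> I"
      using gen unfolding I_def by (blast intro: ideal_gen_add ideal_gen_mult)
    also have "?S (n + 2) * (x + y + z) + (- ?S (n + 1)) * (x * y + y * z + z * x) + x * y * z * ?S n = ?S k"
      by (simp add: k power_add power2_eq_square power3_eq_cube algebra_simps)
    finally show ?thesis .
  qed
qed

lemma not_regular_sequence_odd:
  assumes "odd a" "odd b" "odd c"
  shows "\<not> regular_sequence [power_sum a, power_sum b, power_sum c :: 3 mpoly_complex]"
proof (rule not_regular_sequence_if_common_zero)
  \<comment> \<open>The line (0, 0, T), on which \<open>power_sum b\<close> is T^b.\<close>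
  let ?\<sigma> = "\<lambda>i :: 3. if i = 2 then [:0, 1 :: complex:] else 0"
  show "mpoly_eval (\<lambda>c. [:c:]) ?\<sigma> (pvar 0 + pvar 1) = 0"
    by (simp add: poly_const.mpoly_eval_add)
  show "poly (mpoly_eval (\<lambda>c. [:c:]) ?\<sigma> (pvar 2)) 0 = 0"
    by simp
  show "mpoly_eval (\<lambda>c. [:c:]) ?\<sigma> (power_sum b) \<noteq> 0"
    using odd_pos[OF assms(2)]
    by (simp add: poly_const.mpoly_eval_power_sum power_sum_3[OF UNIV_3] zero_power)
qed (use assms power_sum_mem_odd in blast)+

lemma not_regular_sequence_not_dvd_3:
  assumes "\<not> 3 dvd a" "\<not> 3 dvd b" "\<not> 3 dvd c" "b > 1"
  shows "\<not> regular_sequence [power_sum a, power_sum b, power_sum c :: 3 mpoly_complex]"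
proof (rule not_regular_sequence_if_common_zero)
  \<comment> \<open>The line (T, T, -2T) in the plane \<open>?u = 0\<close>. On it
    \<open>power_sum b\<close> is (2 + (-2)^b) T^b, which is nonzero because
    \<open>b > 1\<close>.\<close>
  let ?\<sigma> = "\<lambda>i :: 3. if i = 2 then [:0, - 2 :: complex:] else [:0, 1:]"
  let ?u = "pvar 0 + pvar 1 + (pvar 2 :: 3 mpoly_complex)"
  let ?v = "pvar 0 * pvar 1 + pvar 1 * pvar 2 + pvar 2 * (pvar 0 :: 3 mpoly_complex)"
  have mem: "power_sum k \<in> ideal_gen {?u, ?v}" if "\<not> 3 dvd k" for k
    unfolding power_sum_3_eq using that by (rule power_sum_mem_not_dvd_3)
  show "power_sum a \<in> ideal_gen {?u, ?v}" "power_sum b \<in> ideal_gen {?u, ?v}" "power_sum c \<in> ideal_gen {?u, ?v}"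
    using assms mem by blast+
  show "mpoly_eval (\<lambda>c. [:c:]) ?\<sigma> ?u = 0"
    by (simp add: poly_const.mpoly_eval_add)
  show "poly (mpoly_eval (\<lambda>c. [:c:]) ?\<sigma> ?v) 0 = 0"
    by (simp add: poly_const.mpoly_eval_add poly_const.mpoly_eval_mult)
  have "(- 2 :: complex) ^ b \<noteq> - 2"
  proof
    assume "(- 2 :: complex) ^ b = - 2"
    then have "norm ((- 2 :: complex) ^ b) = 2"
      by simp
    then have "(2::real) ^ b = 2 ^ 1"
      by (simp add: norm_power)
    then show False
      using assms(4) power_inject_exp[of "2::real" b 1] by simp
  qed
  then have "2 + (- 2 :: complex) ^ b \<noteq> 0"
    by (simp add: add_eq_0_iff)
  moreover have "poly (mpoly_eval (\<lambda>c. [:c:]) ?\<sigma> (power_sum b)) 1 = 2 + (- 2 :: complex) ^ b"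
    by (simp add: poly_const.mpoly_eval_power_sum power_sum_3[OF UNIV_3] poly_power)
  ultimately show "mpoly_eval (\<lambda>c. [:c:]) ?\<sigma> (power_sum b) \<noteq> 0"
    by force
qed

section \<open>Divisibility by 6 and the equivalence\<close>

lemma weakly_regular_power_sum_coprime:
  fixes a c t :: nat
  assumes "a > 0" "c > 0" "coprime a c" and t: "t \<in> {2, 3, 4, 5, 7}" and "6 dvd a * (a * t) * c"
  shows "weakly_regular (power_sum a) (power_sum c) (power_sum (a * t) :: 3 mpoly_complex)"
proof -
  have "2 dvd a * (a * t) * c" "3 dvd a * (a * t) * c"
    by (rule dvd_trans[OF _ assms(5)], simp)+
  \<comment> \<open>For odd \<open>t\<close> the prime 2 must divide \<open>a * c\<close>, and for
    \<open>t \<noteq> 3\<close> the prime 3 must; these are the guards of the two conditions on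
    roots.\<close>
  then have two: "even a \<or> even t \<or> even c" and three: "3 dvd a \<or> 3 dvd t \<or> 3 dvd c"
    by (auto simp: prime_dvd_mult_iff)
  show ?thesis
  proof (rule weakly_regular_power_sum[OF assms(1,2) t])
    fix \<eta> :: complex
    assume "odd t" "\<eta> ^ a = - 1"
    with two show "\<eta> ^ c \<noteq> - 1"
      by (intro no_common_zero_odd[OF assms(3)]) auto
  next
    fix w \<zeta> \<eta> :: complex
    assume "t \<noteq> 3" and w: "w\<^sup>2 + w + 1 = 0" "\<zeta> ^ a = w" "\<eta> ^ a = - (w + 1)"
    then have "\<not> 3 dvd t"
      using t by auto
    with three have "3 dvd a * c" by auto
    with w show "\<zeta> ^ c + 1 + \<eta> ^ c \<noteq> 0"
      by (intro no_common_zero_cube_root[OF assms(1-3)])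
  qed
qed

theorem proposition2p13:
  fixes a1 a2 a3 :: nat and A :: "nat set"
  assumes "A = {a1, a2, a3}"
    and "0 < a1" and "a1 < a2" and "a2 < a3"
    and "Gcd {a1, a2, a3} = 1"
    and "\<exists>a t :: nat. 0 < a \<and> t \<in> {2, 3, 4, 5, 7} \<and> a \<in> A \<and> a * t \<in> A"
  shows "regular_sequence [power_sum a1, power_sum a2, power_sum a3 :: 3 mpoly_complex]
    \<longleftrightarrow> [a1 * a2 * a3 = 0] (mod 6)"
proof
  assume reg: "regular_sequence [power_sum a1, power_sum a2, power_sum a3 :: 3 mpoly_complex]"
  have "2 dvd a1 * a2 * a3"
    using reg not_regular_sequence_odd by auto
  \<comment> \<open>The middle exponent exceeds 1, as a positive exponent lies below it.\<close>
  moreover have "3 dvd a1 * a2 * a3"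
    using reg not_regular_sequence_not_dvd_3[of a1 a2 a3] assms(2,3) by (auto simp: prime_dvd_mult_iff)
  ultimately have "2 * 3 dvd a1 * a2 * a3"
    by (intro divides_mult) (simp_all add: coprime_commute)
  then show "[a1 * a2 * a3 = 0] (mod 6)"
    by (simp add: cong_0_iff)
next
  assume "[a1 * a2 * a3 = 0] (mod 6)"
  then have six: "6 dvd a1 * a2 * a3"
    by (simp add: cong_0_iff)
  obtain a t where at: "0 < a" "t \<in> {2, 3, 4, 5, 7}" "a \<in> {a1, a2, a3}" "a * t \<in> {a1, a2, a3}"
    using assms(1,6) by blast
  have "a < a * t"
    using at(1,2) by auto
  have regular: "weakly_regular (power_sum a) (power_sum c) (power_sum (a * t) :: 3 mpoly_complex)"
    if abc: "{a1, a2, a3} = {a, a * t, c}" and prod: "a1 * a2 * a3 = a * (a * t) * c" and "c > 0" for c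
  proof (rule weakly_regular_power_sum_coprime[OF at(1) \<open>c > 0\<close> _ at(2)])
    \<comment> \<open>A divisor of \<open>a\<close> divides \<open>a * t\<close>, so the joint gcd
      is already that of \<open>a\<close> and \<open>c\<close>.\<close>
    have "gcd a c dvd Gcd {a, a * t, c}"
      by (simp add: gcd_greatest_iff dvd_mult2)
    then have "gcd a c dvd 1"
      by (metis abc assms(5))
    then show "coprime a c"
      by (simp add: coprime_iff_gcd_eq_1)
    show "6 dvd a * (a * t) * c"
      using six prod by simp
  qed
  \<comment> \<open>In the sorted triple \<open>a\<close> precedes \<open>a * t\<close>, which
    leaves the three orders of \<open>regular_sequence_power_sum\<close>.\<close>
  have *: "a = a1 \<and> b = a2 \<or> a = a1 \<and> b = a3 \<or> a = a2 \<and> b = a3"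
    if "a < b" "b \<in> {a1, a2, a3}" for b
    using at(3) that assms(3,4) by auto
  consider "a = a1" "a * t = a2" | "a = a1" "a * t = a3" | "a = a2" "a * t = a3"
    using *[OF \<open>a < a * t\<close> at(4)] by blast
  then show "regular_sequence [power_sum a1, power_sum a2, power_sum a3 :: 3 mpoly_complex]"
  proof cases
    case 1
    then show ?thesis
      using regular_sequence_power_sum(1)[OF _ _ _ regular[of a3]] assms(2-4) by simp
  next
    case 2
    then show ?thesis
      using regular_sequence_power_sum(2)[OF _ _ _ regular[of a2]] assms(2-4) by (simp add: insert_commute mult_ac)
  next
    case 3
    then show ?thesis
      using regular_sequence_power_sum(3)[OF _ _ _ regular[of a1]] assms(2-4) by (simp add: insert_commute mult_ac)
  qed
qed

end
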